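(* Every cancellative double semigroup $(S,*_h,*_v)$ is commutative: for all $a,b\in S$, $a *_h b = b *_h a$ and $a *_v b = b *_v a$.
   Context: A double semigroup is a set $S$ equipped with two associative binary operations $*_h$ and $*_v$, not assumed to have units, satisfying the interchange law $(x *_h y) *_v (z *_h w) = (x *_v z) *_h (y *_v w)$ for all $x,y,z,w\in S$. It is cancellative if for all $x,y,c\in S$ each of the four equations $x*_h c = y*_h c$, $c*_h x = c*_h y$, $x*_v c = y*_v c$, $c*_v x = c*_v y$ implies $x=y$. *)

theory Defs
  imports Main
begin

text \<open>The semigroup locales of Main live on a whole type. Here the underlying set is an explicit
  carrier S, so the operations are constrained on S only.\<close>

locale semigroup_on =
  fixes S :: "'a set" and f :: "'a \<Rightarrow> 'a \<Rightarrow> 'a"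
  assumes closed: "\<lbrakk>x \<in> S; y \<in> S\<rbrakk> \<Longrightarrow> f x y \<in> S"
    and assoc: "\<lbrakk>x \<in> S; y \<in> S; z \<in> S\<rbrakk> \<Longrightarrow> f (f x y) z = f x (f y z)"

locale double_semigroup =
  horizontal: semigroup_on S hmult + vertical: semigroup_on S vmult
  for S :: "'a set"
    and hmult :: "'a \<Rightarrow> 'a \<Rightarrow> 'a" (infixl \<open>*\<^sub>h\<close> 70)
    and vmult :: "'a \<Rightarrow> 'a \<Rightarrow> 'a" (infixl \<open>*\<^sub>v\<close> 70) +
  assumes interchange: "\<lbrakk>x \<in> S; y \<in> S; z \<in> S; w \<in> S\<rbrakk> \<Longrightarrow>
    (x *\<^sub>h y) *\<^sub>v (z *\<^sub>h w) = (x *\<^sub>v z) *\<^sub>h (y *\<^sub>v w)"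

locale cancellative_double_semigroup = double_semigroup +
  assumes h_right_cancel: "\<lbrakk>x \<in> S; y \<in> S; c \<in> S; x *\<^sub>h c = y *\<^sub>h c\<rbrakk> \<Longrightarrow> x = y"
    and h_left_cancel: "\<lbrakk>x \<in> S; y \<in> S; c \<in> S; c *\<^sub>h x = c *\<^sub>h y\<rbrakk> \<Longrightarrow> x = y"
    and v_right_cancel: "\<lbrakk>x \<in> S; y \<in> S; c \<in> S; x *\<^sub>v c = y *\<^sub>v c\<rbrakk> \<Longrightarrow> x = y"
    and v_left_cancel: "\<lbrakk>x \<in> S; y \<in> S; c \<in> S; c *\<^sub>v x = c *\<^sub>v y\<rbrakk> \<Longrightarrow> x = y"

end

theory Submission
  imports Defs
begin

text \<open>Arrange a product as a two-by-two array of blocks, padded with copies of some element \<open>e\<close>.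
  Associativity and interchange let a factor slide between horizontally or vertically adjacent
  blocks. Sliding \<open>a\<close> once around the four blocks, while \<open>p\<close> and \<open>b\<close> slide past the place it left,
  turns \<open>(p *\<^sub>v a) *\<^sub>h b\<close> into \<open>(p *\<^sub>h b) *\<^sub>v a\<close>; by cancellation these are equal. With the mirror
  images of this law, \<open>*\<^sub>v\<close> absorbs horizontal factors so freely that horizontal triple products
  are invariant under rotation. Rotations of three and of four factors generate all permutations
  of four factors, so cancelling the last two factors gives commutativity.\<close>

context double_semigroup
begin

text \<open>Read the first factor of \<open>*\<^sub>v\<close> as lying above the second. Interchange
  joins the two bottom rows into one horizontal product, which can be cut again on the other side of
  \<open>z\<close>.\<close>

lemma slide_bottom_row:
  assumes "t \<in> S" "x \<in> S" "z \<in> S" "u \<in> S" "y \<in> S"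
  shows "(t *\<^sub>v (x *\<^sub>h z)) *\<^sub>h (u *\<^sub>v y) = (t *\<^sub>v x) *\<^sub>h (u *\<^sub>v (z *\<^sub>h y))"
proof -
  have "(t *\<^sub>v (x *\<^sub>h z)) *\<^sub>h (u *\<^sub>v y) = (t *\<^sub>h u) *\<^sub>v ((x *\<^sub>h z) *\<^sub>h y)"
    using assms by (simp add: interchange horizontal.closed)
  also have "\<dots> = (t *\<^sub>h u) *\<^sub>v (x *\<^sub>h (z *\<^sub>h y))"
    using assms by (simp add: horizontal.assoc)
  also have "\<dots> = (t *\<^sub>v x) *\<^sub>h (u *\<^sub>v (z *\<^sub>h y))"
    using assms by (simp add: interchange horizontal.closed)
  finally show ?thesis .
qed

text \<open>The axioms survive reversing \<open>*\<^sub>v\<close> and swapping the operations, so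
  one slide yields the other three.\<close>

lemma vertical_mirror: "double_semigroup S (*\<^sub>h) (\<lambda>x y. y *\<^sub>v x)"
  by unfold_locales
    (simp_all add: horizontal.closed vertical.closed horizontal.assoc vertical.assoc interchange)

lemma transposed: "double_semigroup S (*\<^sub>v) (*\<^sub>h)"
  by unfold_locales
    (simp_all add: horizontal.closed vertical.closed horizontal.assoc vertical.assoc interchange)

lemma slide_top_row:
  assumes "t \<in> S" "x \<in> S" "z \<in> S" "u \<in> S" "y \<in> S"
  shows "((x *\<^sub>h z) *\<^sub>v t) *\<^sub>h (y *\<^sub>v u) = (x *\<^sub>v t) *\<^sub>h ((z *\<^sub>h y) *\<^sub>v u)"
  using double_semigroup.slide_bottom_row[OF vertical_mirror] assms by blast

lemmas slide_right_column = double_semigroup.slide_bottom_row[OF transposed]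
  and slide_left_column = double_semigroup.slide_top_row[OF transposed]

end

context cancellative_double_semigroup
begin

lemma horizontal_mirror_cancellative:
  "cancellative_double_semigroup S (\<lambda>x y. y *\<^sub>h x) (*\<^sub>v)"
  by unfold_locales
    (simp_all add: horizontal.closed vertical.closed horizontal.assoc vertical.assoc interchange,
      (blast intro: h_right_cancel h_left_cancel v_right_cancel v_left_cancel)+)

lemma vertical_mirror_cancellative:
  "cancellative_double_semigroup S (*\<^sub>h) (\<lambda>x y. y *\<^sub>v x)"
  by unfold_locales
    (simp_all add: horizontal.closed vertical.closed horizontal.assoc vertical.assoc interchange,
      (blast intro: h_right_cancel h_left_cancel v_right_cancel v_left_cancel)+)

lemma transposed_cancellative: "cancellative_double_semigroup S (*\<^sub>v) (*\<^sub>h)"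
  by unfold_locales
    (simp_all add: horizontal.closed vertical.closed horizontal.assoc vertical.assoc interchange,
      (blast intro: h_right_cancel h_left_cancel v_right_cancel v_left_cancel)+)

lemma absorb_top_right:
  assumes "p \<in> S" "a \<in> S" "b \<in> S"
  shows "(p *\<^sub>v a) *\<^sub>h b = (p *\<^sub>h b) *\<^sub>v a"
proof -
  \<comment> \<open>Any element of \<open>S\<close> could pad; the separate name keeps padding apart
    from the moving factor \<open>a\<close>.\<close>
  define e where "e = a"
  have e: "e \<in> S" using assms by (simp add: e_def)
  note S = e assms horizontal.closed vertical.closed
  \<comment> \<open>A and B start as the top blocks, C and D as the bottom ones; digits mark stages.
    \<open>A0\<close> and \<open>C0\<close> have a row with a single \<open>e\<close>, which
    receives the factor sliding left; the block that gives it up then becomes \<open>A0\<close> or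
    \<open>C0\<close> itself.\<close>
  define A0 where "A0 = (e *\<^sub>h e) *\<^sub>v e"
  define A1 where "A1 = (e *\<^sub>h e) *\<^sub>v (e *\<^sub>h (p *\<^sub>h b))"
  define A2 where "A2 = (e *\<^sub>h e) *\<^sub>v (e *\<^sub>h ((p *\<^sub>h b) *\<^sub>v a))"
  define B0 where "B0 = (e *\<^sub>h e) *\<^sub>v ((p *\<^sub>v a) *\<^sub>h (b *\<^sub>h e))"
  define B1 where "B1 = (e *\<^sub>h e) *\<^sub>v (p *\<^sub>h (b *\<^sub>h e))"
  define C0 where "C0 = e *\<^sub>v (e *\<^sub>h e)"
  define C1 where "C1 = (e *\<^sub>h (a *\<^sub>v e)) *\<^sub>v (e *\<^sub>h e)"
  define D0 where "D0 = (e *\<^sub>h e) *\<^sub>v (e *\<^sub>h e)"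
  define D1 where "D1 = ((a *\<^sub>v e) *\<^sub>h e) *\<^sub>v (e *\<^sub>h e)"
  note blocks = A0_def A1_def A2_def B0_def B1_def C0_def C1_def D0_def D1_def
  have in_S: "A0 \<in> S" "A1 \<in> S" "A2 \<in> S" "B0 \<in> S" "B1 \<in> S" "C0 \<in> S" "C1 \<in> S" "D0 \<in> S" "D1 \<in> S"
    unfolding blocks using S by simp_all
  have a_down: "B0 *\<^sub>v D0 = B1 *\<^sub>v D1"
  proof -
    have "B0 *\<^sub>v D0 =
        (((e *\<^sub>v p) *\<^sub>v a) *\<^sub>h (e *\<^sub>v (b *\<^sub>h e))) *\<^sub>v ((e *\<^sub>v e) *\<^sub>h (e *\<^sub>v e))"
      unfolding blocks using S by (simp add: interchange vertical.assoc)
    also have "\<dots> = ((e *\<^sub>v p) *\<^sub>h (e *\<^sub>v (b *\<^sub>h e))) *\<^sub>v ((a *\<^sub>v (e *\<^sub>v e)) *\<^sub>h (e *\<^sub>v e))"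
      using S by (intro slide_left_column) simp_all
    also have "\<dots> = B1 *\<^sub>v D1"
      unfolding blocks using S by (simp add: interchange vertical.assoc)
    finally show ?thesis .
  qed
  have a_left: "C0 *\<^sub>h D1 = C1 *\<^sub>h C0"
    unfolding blocks using S slide_top_row[of "e *\<^sub>h e" e "a *\<^sub>v e" "e *\<^sub>h e" e] by simp
  have pb_left: "A0 *\<^sub>h B1 = A1 *\<^sub>h A0"
    unfolding blocks using S slide_bottom_row[of "e *\<^sub>h e" e "p *\<^sub>h b" "e *\<^sub>h e" e]
    by (simp add: horizontal.assoc)
  have a_up: "A1 *\<^sub>v C1 = A2 *\<^sub>v D0"
  proof -
    have "A2 *\<^sub>v D0 =
        ((e *\<^sub>v e) *\<^sub>h ((e *\<^sub>v (p *\<^sub>h b)) *\<^sub>v a)) *\<^sub>v ((e *\<^sub>v e) *\<^sub>h (e *\<^sub>v e))"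
      unfolding blocks using S by (simp add: interchange vertical.assoc)
    also have "\<dots> = ((e *\<^sub>v e) *\<^sub>h (e *\<^sub>v (p *\<^sub>h b))) *\<^sub>v ((e *\<^sub>v e) *\<^sub>h (a *\<^sub>v (e *\<^sub>v e)))"
      using S by (intro slide_right_column) simp_all
    also have "\<dots> = A1 *\<^sub>v C1"
      unfolding blocks using S by (simp add: interchange vertical.assoc)
    finally show ?thesis by simp
  qed
  \<comment> \<open>After the circuit the bottom blocks stand in swapped order; sliding one
    \<open>e\<close> restores the original bottom row, ready to be cancelled.\<close>
  have pad: "D0 *\<^sub>h C0 = C0 *\<^sub>h D0"
    unfolding blocks using S slide_top_row[of "e *\<^sub>h e" e e "e *\<^sub>h e" e] by simp
  have "(A0 *\<^sub>h B0) *\<^sub>v (C0 *\<^sub>h D0) = (A0 *\<^sub>v C0) *\<^sub>h (B1 *\<^sub>v D1)"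
    using in_S by (simp add: interchange a_down)
  also have "\<dots> = (A0 *\<^sub>h B1) *\<^sub>v (C0 *\<^sub>h D1)"
    using in_S by (simp add: interchange)
  also have "\<dots> = (A1 *\<^sub>v C1) *\<^sub>h (A0 *\<^sub>v C0)"
    using in_S by (simp add: a_left pb_left interchange)
  also have "\<dots> = (A2 *\<^sub>h A0) *\<^sub>v (C0 *\<^sub>h D0)"
    using in_S by (simp add: a_up flip: interchange pad)
  finally have "A0 *\<^sub>h B0 = A2 *\<^sub>h A0"
    using in_S by (blast intro: v_right_cancel S)
  \<comment> \<open>Sliding \<open>(p *\<^sub>h b) *\<^sub>v a\<close> back to the right puts
    \<open>A0\<close> in front on both sides.\<close>
  also have "\<dots> = A0 *\<^sub>h ((e *\<^sub>h e) *\<^sub>v (((p *\<^sub>h b) *\<^sub>v a) *\<^sub>h e))"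
    unfolding blocks using S by (intro slide_bottom_row) simp_all
  finally have "B0 = (e *\<^sub>h e) *\<^sub>v (((p *\<^sub>h b) *\<^sub>v a) *\<^sub>h e)"
    using in_S by (blast intro: h_left_cancel S)
  then have "((p *\<^sub>v a) *\<^sub>h b) *\<^sub>h e = ((p *\<^sub>h b) *\<^sub>v a) *\<^sub>h e"
    unfolding B0_def using S by (simp add: horizontal.assoc) (blast intro: v_left_cancel S)
  then show ?thesis by (blast intro: h_right_cancel S)
qed

lemma absorb_top_left:
  assumes "p \<in> S" "a \<in> S" "b \<in> S"
  shows "b *\<^sub>h (p *\<^sub>v a) = (b *\<^sub>h p) *\<^sub>v a"
  using cancellative_double_semigroup.absorb_top_right[OF horizontal_mirror_cancellative] assms
  by blast

lemma absorb_bottom_right: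
  assumes "p \<in> S" "a \<in> S" "b \<in> S"
  shows "(a *\<^sub>v p) *\<^sub>h b = a *\<^sub>v (p *\<^sub>h b)"
  using cancellative_double_semigroup.absorb_top_right[OF vertical_mirror_cancellative] assms
  by blast

lemma absorb_bottom_left:
  assumes "p \<in> S" "a \<in> S" "b \<in> S"
  shows "b *\<^sub>h (a *\<^sub>v p) = a *\<^sub>v (b *\<^sub>h p)"
  using cancellative_double_semigroup.absorb_top_left[OF vertical_mirror_cancellative] assms
  by blast

text \<open>Both sides equal \<open>(x *\<^sub>h r) *\<^sub>v w\<close>: the left one by the two
  left absorption laws, the right one by the two right ones.\<close>

lemma vmult_hmult_rotate:
  assumes "r \<in> S" "x \<in> S" "w \<in> S"
  shows "r *\<^sub>v (x *\<^sub>h w) = x *\<^sub>v (w *\<^sub>h r)"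
  using assms by (metis absorb_top_left absorb_bottom_left absorb_top_right absorb_bottom_right)

text \<open>An auxiliary \<open>x\<close> on top makes the preceding rotation applicable. Three such
  rotations bring \<open>z *\<^sub>h x\<close> to the top, from where left absorption frees an
  \<open>x\<close> to cancel.\<close>

lemma hmult_rotate:
  assumes "x \<in> S" "y \<in> S" "z \<in> S"
  shows "x *\<^sub>h (y *\<^sub>h z) = z *\<^sub>h (x *\<^sub>h y)"
proof -
  note S = assms horizontal.closed
  have "x *\<^sub>v (x *\<^sub>h (y *\<^sub>h z)) = x *\<^sub>v (y *\<^sub>h (z *\<^sub>h x))"
    using S vmult_hmult_rotate[of x x "y *\<^sub>h z"] by (simp add: horizontal.assoc)
  also have "\<dots> = y *\<^sub>v ((z *\<^sub>h x) *\<^sub>h x)"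
    using S by (intro vmult_hmult_rotate) simp_all
  also have "\<dots> = (z *\<^sub>h x) *\<^sub>v (x *\<^sub>h y)"
    using S by (intro vmult_hmult_rotate) simp_all
  also have "\<dots> = x *\<^sub>v (z *\<^sub>h (x *\<^sub>h y))"
    using S by (metis absorb_top_left absorb_bottom_left)
  finally show ?thesis by (blast intro: v_left_cancel S)
qed

lemma hmult_commute:
  assumes "a \<in> S" "b \<in> S"
  shows "a *\<^sub>h b = b *\<^sub>h a"
proof -
  note S = assms horizontal.closed
  have "(a *\<^sub>h b) *\<^sub>h (a *\<^sub>h a) = a *\<^sub>h (b *\<^sub>h (a *\<^sub>h a))"
    using S by (simp add: horizontal.assoc)
  \<comment> \<open>Rotating the last three factors sends \<open>b\<close> from second place to the
    end; rotating all four then brings it to the front.\<close>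
  also have "\<dots> = a *\<^sub>h (a *\<^sub>h (a *\<^sub>h b))"
    using S hmult_rotate[of a a b] by simp
  also have "\<dots> = b *\<^sub>h (a *\<^sub>h (a *\<^sub>h a))"
    using S hmult_rotate[of a "a *\<^sub>h a" b] by (simp add: horizontal.assoc)
  also have "\<dots> = (b *\<^sub>h a) *\<^sub>h (a *\<^sub>h a)"
    using S by (simp add: horizontal.assoc)
  finally show ?thesis by (blast intro: h_right_cancel S)
qed

end

theorem corollary2p5:
  fixes S :: "'a set"
    and hmult :: "'a \<Rightarrow> 'a \<Rightarrow> 'a" (infixl \<open>*\<^sub>h\<close> 70)
    and vmult :: "'a \<Rightarrow> 'a \<Rightarrow> 'a" (infixl \<open>*\<^sub>v\<close> 70)
  assumes "cancellative_double_semigroup S (*\<^sub>h) (*\<^sub>v)"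
  shows "\<forall>a\<in>S. \<forall>b\<in>S. a *\<^sub>h b = b *\<^sub>h a \<and> a *\<^sub>v b = b *\<^sub>v a"
proof -
  interpret cancellative_double_semigroup S "(*\<^sub>h)" "(*\<^sub>v)" by (fact assms)
  show ?thesis
    using hmult_commute cancellative_double_semigroup.hmult_commute[OF transposed_cancellative]
    by blast
qed

end
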